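(* Let $n$ be a positive integer. Any $n\times n$ strictly upper triangular matrix of an $H(k,l;m)$-formation, where $1\le k<m<l\le n$, is CN-realizable.
   Context: $H(k,l;m)$-formation. For $1\le k<m<l\le n$, a strictly upper triangular $n\times n$ matrix $M$ has an $H(k,l;m)$-formation if: - $M(k,m+1)=M(k,l)=M(m,l)=M(m,m+1)=2$; - $M(k,j)=2$ for $k<j\le m-1$; - $M(i,l)=2$ for $m+2\le i<l$; - each of $M(k,m)$, $M(m+1,l)$, $M(m-1,m+1)$, $M(m,m+2)$ is either $0$ or $2$ (no condition if the position lies outside the matrix; if the position is one of those listed in the previous lines, its value is the $2$ required there; if it is on the diagonal, its value is $0$); - all other entries are $0$. Braid projections. An $n$-braid projection $B$ consists of $n$ strands in the plane, each running monotonically downward from one of $n$ points on an upper horizontal bar to one of $n$ points on a lower horizontal bar, meeting each other only in finitely many transverse double points (crossings), with no over/under information. The strands are named $s_1,\dots,s_n$ from left to right at the top. Combinatorially, $B$ is encoded by a finite word with letters in $\{1,\dots,n-1\}$: reading from top to bottom, the letter $k$ means that the two strands currently in positions $k$ and $k+1$ cross once and exchange positions (no reduction is assumed). The CN matrix $N(B)$ is the symmetric zero-diagonal $n\times n$ matrix whose $(i,j)$ entry ($i\neq j$) is the number of crossings between $s_i$ and $s_j$. CN matrices are represented by strictly upper triangular matrices: a strictly upper triangular $n\times n$ matrix $M$ is CN-realizable if there is an $n$-braid projection $B$ with $M(i,j)=N(B)(i,j)$ for all $1\le i<j\le n$. *)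

theory Defs
  imports "Jordan_Normal_Form.Matrix" "HOL-Combinatorics.Transposition"
begin

text \<open>Matrices of the library are indexed from 0; strands, positions and the entries of the
  matrices considered here are indexed from 1.\<close>

definition entry :: "'a mat \<Rightarrow> nat \<Rightarrow> nat \<Rightarrow> 'a" where
  "entry M i j = M $$ (i - 1, j - 1)"

definition strictly_upper_triangular :: "nat \<Rightarrow> 'a::zero mat \<Rightarrow> bool" where
  "strictly_upper_triangular n M \<longleftrightarrow>
     M \<in> carrier_mat n n \<and> (\<forall>i\<in>{1..n}. \<forall>j\<in>{1..n}. j \<le> i \<longrightarrow> entry M i j = 0)"

definition braid_projection :: "nat \<Rightarrow> nat list \<Rightarrow> bool" where
  "braid_projection n w \<longleftrightarrow> set w \<subseteq> {1..<n}"

text \<open>The function \<open>p\<close> records which strand currently occupies each position, so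
  initially it is the identity.\<close>

fun crossings_from :: "(nat \<Rightarrow> nat) \<Rightarrow> nat list \<Rightarrow> nat \<Rightarrow> nat \<Rightarrow> nat" where
  "crossings_from p [] i j = 0"
| "crossings_from p (a # w) i j =
     (if {p a, p (a + 1)} = {i, j} then 1 else 0)
       + crossings_from (p \<circ> Transposition.transpose a (a + 1)) w i j"

definition crossings :: "nat list \<Rightarrow> nat \<Rightarrow> nat \<Rightarrow> nat" where
  "crossings w i j = crossings_from id w i j"

definition CN_matrix :: "nat \<Rightarrow> nat list \<Rightarrow> nat mat" where
  "CN_matrix n w = mat n n (\<lambda>(i, j). if i = j then 0 else crossings w (i + 1) (j + 1))"

definition CN_realizable :: "nat \<Rightarrow> nat mat \<Rightarrow> bool" where
  "CN_realizable n M \<longleftrightarrow> strictly_upper_triangular n M \<and>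
     (\<exists>w. braid_projection n w \<and>
        (\<forall>i j. 1 \<le> i \<and> i < j \<and> j \<le> n \<longrightarrow> entry M i j = entry (CN_matrix n w) i j))"

definition H_required :: "nat \<Rightarrow> nat \<Rightarrow> nat \<Rightarrow> (nat \<times> nat) set" where
  "H_required k l m = {(k, m + 1), (k, l), (m, l), (m, m + 1)}
     \<union> {(k, j) | j. k < j \<and> j \<le> m - 1}
     \<union> {(i, l) | i. m + 2 \<le> i \<and> i < l}"

definition H_optional :: "nat \<Rightarrow> nat \<Rightarrow> nat \<Rightarrow> (nat \<times> nat) set" where
  "H_optional k l m = {(k, m), (m + 1, l), (m - 1, m + 1), (m, m + 2)}"

text \<open>A required position takes precedence over an optional one; optional positions outside
  the matrix are not constrained, and an optional position on the diagonal (which occurs for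
  \<open>l = m + 1\<close>) carries the value 0.\<close>

definition H_formation :: "nat \<Rightarrow> nat \<Rightarrow> nat \<Rightarrow> nat \<Rightarrow> nat mat \<Rightarrow> bool" where
  "H_formation n k l m M \<longleftrightarrow>
     1 \<le> k \<and> k < m \<and> m < l \<and> l \<le> n \<and> strictly_upper_triangular n M \<and>
     (\<forall>i\<in>{1..n}. \<forall>j\<in>{1..n}.
        if (i, j) \<in> H_required k l m then entry M i j = 2
        else if (i, j) \<in> H_optional k l m \<and> i \<noteq> j then entry M i j \<in> {0, 2}
        else entry M i j = 0)"

end

theory Submission imports Defs begin

text \<open>Half of the braid is a word \<open>u\<close> in which every required pair crosses exactly once: first
  \<open>m\<close> and \<open>m + 1\<close> cross, then strand \<open>k\<close> slides right up to strand \<open>m\<close>, strand \<open>l\<close> slides left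
  past strand \<open>m\<close>, and finally \<open>k\<close> and \<open>l\<close> cross. At that level the strands appear in the order
  \<open>k + 1, \<dots>, m - 1, m + 1, l, k, m, m + 2, \<dots>, l - 1\<close>, so each optional pair is adjacent and
  may cross twice there. Running \<open>u\<close> backwards doubles all crossings of \<open>u\<close>. For \<open>l = m + 1\<close> the
  same works with the first two stages only.\<close>

section \<open>Arrangements of strands and palindromic words\<close>

fun arrangement_after :: "(nat \<Rightarrow> nat) \<Rightarrow> nat list \<Rightarrow> nat \<Rightarrow> nat" where
  "arrangement_after p [] = p"
| "arrangement_after p (a # w) = arrangement_after (p \<circ> Transposition.transpose a (a + 1)) w"

lemma arrangement_after_append [simp]:
  "arrangement_after p (u @ v) = arrangement_after (arrangement_after p u) v"
  by (induction u arbitrary: p) auto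

lemma crossings_from_append [simp]:
  "crossings_from p (u @ v) i j
     = crossings_from p u i j + crossings_from (arrangement_after p u) v i j"
  by (induction u arbitrary: p) auto

lemma inj_arrangement_after:
  assumes "inj p"
  shows "inj (arrangement_after p w)"
  using assms
proof (induction w arbitrary: p)
  case (Cons a w)
  have "inj (p \<circ> Transposition.transpose a (a + 1))"
    using Cons.prems by (intro inj_compose) auto
  then show ?case
    using Cons.IH by simp
qed simp

lemma arrangement_after_palindrome:
  assumes "\<And>p. arrangement_after p d = p"
  shows "arrangement_after p (u @ d @ rev u) = p"
  using assms by (induction u arbitrary: p) (auto simp: comp_assoc)

text \<open>The letters of \<open>rev u\<close> undo those of \<open>u\<close> level by level, since
  \<open>d\<close> restores the arrangement. Each crossing made by \<open>u\<close> is therefore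
  repeated once by the same two strands.\<close>

lemma crossings_from_palindrome:
  assumes "\<And>p. arrangement_after p d = p"
  shows "crossings_from p (u @ d @ rev u) i j
           = 2 * crossings_from p u i j + crossings_from (arrangement_after p u) d i j"
proof (induction u arbitrary: p)
  case (Cons a u)
  let ?q = "p \<circ> Transposition.transpose a (a + 1)"
  have "crossings_from p ((a # u) @ d @ rev (a # u)) i j
      = (if {p a, p (a + 1)} = {i, j} then 1 else 0)
        + crossings_from ?q ((u @ d @ rev u) @ [a]) i j"
    by simp
  also have "crossings_from ?q ((u @ d @ rev u) @ [a]) i j
      = crossings_from ?q (u @ d @ rev u) i j + (if {?q a, ?q (a + 1)} = {i, j} then 1 else 0)"
    unfolding crossings_from_append[of ?q "u @ d @ rev u"]
      arrangement_after_palindrome[OF assms] by simp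
  \<comment> \<open>The closing letter \<open>a\<close> meets the two strands that the opening
    \<open>a\<close> exchanged, in swapped positions; as an unordered pair they are the
    same.\<close>
  also have "{?q a, ?q (a + 1)} = {p a, p (a + 1)}"
    by auto
  finally show ?case
    unfolding Cons.IH by simp
qed simp

section \<open>Doubled letters: twists that restore the arrangement\<close>

definition doubled :: "nat list \<Rightarrow> nat list" where
  "doubled cs = concat (map (\<lambda>c. [c, c]) cs)"

lemma set_doubled [simp]: "set (doubled cs) = set cs"
  by (auto simp: doubled_def)

lemma arrangement_after_doubled [simp]: "arrangement_after p (doubled cs) = p"
  by (induction cs) (auto simp: doubled_def comp_assoc)

text \<open>Every letter acts on the same arrangement \<open>p\<close>, because each preceding twist
  is trivial on positions. As \<open>p\<close> is injective, a pair of strands is adjacent at one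
  place at most, so distinct letters never count the same pair twice.\<close>

lemma crossings_from_doubled:
  assumes "inj p" "distinct cs"
  shows "crossings_from p (doubled cs) i j
    = (if \<exists>c\<in>set cs. {p c, p (c + 1)} = {i, j} then 2 else 0)"
  using assms(2)
proof (induction cs)
  case Nil
  then show ?case
    by (simp add: doubled_def)
next
  case (Cons c cs)
  have doubled_Cons: "doubled (c # cs) = [c, c] @ doubled cs"
    by (simp add: doubled_def)
  have restored: "arrangement_after p [c, c] = p"
    by (simp add: comp_assoc)
  have twice: "crossings_from p [c, c] i j = (if {p c, p (c + 1)} = {i, j} then 2 else 0)"
    by (simp add: insert_commute)
  have "\<not> (\<exists>c'\<in>set cs. {p c', p (c' + 1)} = {i, j})" if "{p c, p (c + 1)} = {i, j}"
  proof
    assume "\<exists>c'\<in>set cs. {p c', p (c' + 1)} = {i, j}"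
    then obtain c' where "c' \<in> set cs" and c': "{p c', p (c' + 1)} = {i, j}"
      by blast
    have "{p c', p (c' + 1)} = {p c, p (c + 1)}"
      by (rule trans[OF c' that[symmetric]])
    then have "c' = c"
      using assms(1) by (auto simp: doubleton_eq_iff inj_eq)
    then show False
      using \<open>c' \<in> set cs\<close> Cons.prems by simp
  qed
  then show ?case
    using Cons unfolding doubled_Cons crossings_from_append restored twice
    by (cases "{p c, p (c + 1)} = {i, j}") simp_all
qed

section \<open>Sliding one strand across a block of positions\<close>

lemma arrangement_after_slide_right:
  assumes "a \<le> b"
  shows "arrangement_after p [a..<b] =
    (\<lambda>r. if a \<le> r \<and> r < b then p (r + 1) else if r = b then p a else p r)"
  using assms
proof (induction b rule: dec_induct)
  case (step b)
  then show ?case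
    by (auto simp: fun_eq_iff Transposition.transpose_def)
qed auto

lemma crossings_from_slide_right:
  assumes "inj p" "a \<le> b"
  shows "crossings_from p [a..<b] i j = (if \<exists>c\<in>{a<..b}. {p a, p c} = {i, j} then 1 else 0)"
  using assms(2)
proof (induction b rule: dec_induct)
  case (step b)
  \<comment> \<open>The new last letter \<open>b\<close> makes the sliding strand \<open>p a\<close>
    cross \<open>p (Suc b)\<close>; by injectivity this strand was not met before, so the count
    stays at most 1.\<close>
  have "\<not> (\<exists>c\<in>{a<..b}. {p a, p c} = {i, j})" if "{p a, p (Suc b)} = {i, j}"
    using that assms(1) by (auto simp: doubleton_eq_iff inj_eq)
  moreover have "{a<..Suc b} = insert (Suc b) {a<..b}"
    using step.hyps by auto
  ultimately show ?case
    using step by (auto simp: arrangement_after_slide_right)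
qed simp

lemma arrangement_after_slide_left:
  assumes "a \<le> b"
  shows "arrangement_after p (rev [a..<b]) =
    (\<lambda>r. if r = a then p b else if a < r \<and> r \<le> b then p (r - 1) else p r)"
  using assms
proof (induction b arbitrary: p rule: dec_induct)
  case (step b)
  then show ?case
    by (auto simp: fun_eq_iff Transposition.transpose_def)
qed auto

lemma crossings_from_slide_left:
  assumes "inj p" "a \<le> b"
  shows "crossings_from p (rev [a..<b]) i j = (if \<exists>c\<in>{a..<b}. {p c, p b} = {i, j} then 1 else 0)"
  using assms(2,1)
proof (induction b arbitrary: p rule: dec_induct)
  case (step b)
  let ?q = "p \<circ> Transposition.transpose b (b + 1)"
  have "inj ?q"
    using step.prems by (intro inj_compose) auto
  have "(\<exists>c\<in>{a..<b}. {?q c, ?q b} = {i, j}) \<longleftrightarrow> (\<exists>c\<in>{a..<b}. {p c, p (Suc b)} = {i, j})"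
    by (intro bex_cong) (auto simp: Transposition.transpose_def)
  then have IH: "crossings_from ?q (rev [a..<b]) i j
      = (if \<exists>c\<in>{a..<b}. {p c, p (Suc b)} = {i, j} then 1 else 0)"
    using step.IH[OF \<open>inj ?q\<close>] by (simp only:)
  have "\<not> (\<exists>c\<in>{a..<b}. {p c, p (Suc b)} = {i, j})" if "{p b, p (Suc b)} = {i, j}"
    using that step.prems by (auto simp: doubleton_eq_iff inj_eq)
  moreover have "{a..<Suc b} = insert b {a..<b}"
    using step.hyps by auto
  moreover have "rev [a..<Suc b] = b # rev [a..<b]"
    using step.hyps by simp
  ultimately show ?case
    using IH by (simp del: upt_Suc)
qed simp

section \<open>Realizability from a half-braid and adjacencies at its lowest level\<close>

lemma CN_realizable_if_adjacent:
  assumes M: "strictly_upper_triangular n M"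
    and u: "set u \<subseteq> {1..<n}"
    and q: "q = arrangement_after id u"
    and entries: "\<And>i j. 1 \<le> i \<Longrightarrow> i < j \<Longrightarrow> j \<le> n \<Longrightarrow>
      crossings_from id u i j = 1 \<and> entry M i j = 2 \<or>
      crossings_from id u i j = 0 \<and>
        (entry M i j = 0 \<or> entry M i j = 2 \<and> (\<exists>c\<in>{1..<n}. {q c, q (c + 1)} = {i, j}))"
  shows "CN_realizable n M"
proof -
  \<comment> \<open>A twist is wanted only where the entry is 2 and the pair has not crossed in
    \<open>u\<close>: pairs crossing there already reach 2 through \<open>rev u\<close>.\<close>
  define optional where "optional c \<longleftrightarrow> (\<exists>i j. i < j \<and> {q c, q (c + 1)} = {i, j} \<and>
    crossings_from id u i j = 0 \<and> entry M i j = 2)" for c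
  define d where "d = doubled (filter optional [1..<n])"
  have "inj q"
    unfolding q by (intro inj_arrangement_after) simp
  have d: "crossings_from q d i j = (if \<exists>c\<in>{1..<n}. optional c \<and> {q c, q (c + 1)} = {i, j}
      then 2 else 0)" for i j
    unfolding d_def using crossings_from_doubled[OF \<open>inj q\<close>, of "filter optional [1..<n]" i j]
    by (simp add: Bex_def conj_ac)
  \<comment> \<open>An unordered pair has only one increasing listing, so the existential choice of
    \<open>i\<close> and \<open>j\<close> in the definition is forced.\<close>
  have optional: "optional c \<longleftrightarrow> crossings_from id u i j = 0 \<and> entry M i j = 2"
    if eq: "{q c, q (c + 1)} = {i, j}" and less: "i < j" for c i j
  proof -
    have unique: "i' = i \<and> j' = j" if "i' < j'" "{i, j} = {i', j'}" for i' j'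
      using that less by (auto simp: doubleton_eq_iff)
    show ?thesis
    proof
      assume "optional c"
      then obtain i' j' where "i' < j'" "{i, j} = {i', j'}"
        and "crossings_from id u i' j' = 0" "entry M i' j' = 2"
        unfolding optional_def eq by blast
      then show "crossings_from id u i j = 0 \<and> entry M i j = 2"
        using unique by simp
    next
      assume "crossings_from id u i j = 0 \<and> entry M i j = 2"
      then show "optional c"
        unfolding optional_def using eq less by blast
    qed
  qed
  have crossings: "crossings (u @ d @ rev u) i j = 2 * crossings_from id u i j + crossings_from q d i j"
    for i j
    unfolding crossings_def q by (rule crossings_from_palindrome) (simp add: d_def)
  have count: "entry M i j = crossings (u @ d @ rev u) i j" if ij: "1 \<le> i" "i < j" "j \<le> n" for i j
  proof -
    have "crossings_from q d i j = (if crossings_from id u i j = 0 \<and> entry M i j = 2 \<and>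
        (\<exists>c\<in>{1..<n}. {q c, q (c + 1)} = {i, j}) then 2 else 0)"
      unfolding d using optional[OF _ ij(2)] by (intro if_cong refl) blast
    then show ?thesis
      unfolding crossings using entries[OF ij] by auto
  qed
  show ?thesis
    unfolding CN_realizable_def
  proof (intro conjI exI[of _ "u @ d @ rev u"] allI impI M)
    show "braid_projection n (u @ d @ rev u)"
      using u by (auto simp: braid_projection_def d_def)
    fix i j assume "1 \<le> i \<and> i < j \<and> j \<le> n"
    then show "entry M i j = entry (CN_matrix n (u @ d @ rev u)) i j"
      using count[of i j] by (auto simp: entry_def CN_matrix_def)
  qed
qed

section \<open>Required and optional positions of an H-formation\<close>

lemma H_required_iff:
  "(i, j) \<in> H_required k l m \<longleftrightarrow>
    i = k \<and> (j = m + 1 \<or> j = l \<or> k < j \<and> j \<le> m - 1) \<or>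
    i = m \<and> (j = l \<or> j = m + 1) \<or> j = l \<and> m + 2 \<le> i \<and> i < l"
  unfolding H_required_def by blast

lemma H_optional_iff:
  "(i, j) \<in> H_optional k l m \<longleftrightarrow>
    i = k \<and> j = m \<or> i = m + 1 \<and> j = l \<or> i = m - 1 \<and> j = m + 1 \<or> i = m \<and> j = m + 2"
  unfolding H_optional_def by blast

text \<open>This leaves only two facts to check for a concrete word \<open>u\<close>: which pairs it
  crosses, and that the remaining optional pairs inside the matrix end up adjacent.\<close>

lemma H_formation_CN_realizable:
  assumes H: "H_formation n k l m M"
    and u: "set u \<subseteq> {1..<n}"
    and q: "q = arrangement_after id u"
    and required: "\<And>i j. i < j \<Longrightarrow>
      crossings_from id u i j = (if (i, j) \<in> H_required k l m then 1 else 0)"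
    and optional: "\<And>i j. 1 \<le> i \<Longrightarrow> i < j \<Longrightarrow> j \<le> n \<Longrightarrow> (i, j) \<notin> H_required k l m \<Longrightarrow>
      (i, j) \<in> H_optional k l m \<Longrightarrow> \<exists>c\<in>{1..<n}. {q c, q (c + 1)} = {i, j}"
  shows "CN_realizable n M"
proof (rule CN_realizable_if_adjacent[OF _ u q])
  show "strictly_upper_triangular n M"
    using H by (simp add: H_formation_def)
  fix i j assume ij: "1 \<le> i" "i < j" "j \<le> n"
  then have "i \<in> {1..n}" "j \<in> {1..n}"
    by auto
  then have "if (i, j) \<in> H_required k l m then entry M i j = 2
        else if (i, j) \<in> H_optional k l m \<and> i \<noteq> j then entry M i j \<in> {0, 2}
        else entry M i j = 0"
    using H unfolding H_formation_def by blast
  then show "crossings_from id u i j = 1 \<and> entry M i j = 2 \<or>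
      crossings_from id u i j = 0 \<and>
        (entry M i j = 0 \<or> entry M i j = 2 \<and> (\<exists>c\<in>{1..<n}. {q c, q (c + 1)} = {i, j}))"
    using required[OF ij(2)] optional[OF ij] ij(2) by (metis empty_iff insert_iff less_irrefl)
qed

section \<open>The two stages common to all values of \<open>l\<close>\<close>

context
  fixes k m :: nat
  assumes km: "1 \<le> k" "k < m"
begin

text \<open>The letter \<open>m\<close> comes first so that strand \<open>m + 1\<close> stands in
  position \<open>m\<close>: sliding strand \<open>k\<close> to position \<open>m\<close> then
  passes \<open>m + 1\<close> but not strand \<open>m\<close>.\<close>

definition first_stages :: "nat list" where
  "first_stages = m # [k..<m]"

lemma arrangement_after_first_stages:
  "arrangement_after id first_stages =
    (\<lambda>r. if k \<le> r \<and> r < m - 1 then r + 1 else if r = m - 1 then m + 1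
         else if r = m then k else if r = m + 1 then m else r)"
  using km by (auto simp: first_stages_def arrangement_after_slide_right fun_eq_iff
      Transposition.transpose_def)

lemma crossings_from_first_stages:
  assumes "i < j"
  shows "crossings_from id first_stages i j =
    (if (i = m \<and> j = m + 1) \<or> (i = k \<and> (k < j \<and> j < m \<or> j = m + 1)) then 1 else 0)"
proof -
  let ?t = "Transposition.transpose m (m + 1)"
  \<comment> \<open>Position \<open>m\<close> is split off because it holds strand
    \<open>m + 1\<close>, while the positions strictly between \<open>k\<close> and \<open>m\<close>
    still hold their own strands.\<close>
  have "{k<..m} = insert m {k<..<m}"
    using km by auto
  then have "(\<exists>c\<in>{k<..m}. {?t k, ?t c} = {i, j})
      \<longleftrightarrow> {k, m + 1} = {i, j} \<or> (\<exists>c\<in>{k<..<m}. {k, c} = {i, j})"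
    using km by simp
  also have "\<dots> \<longleftrightarrow> i = k \<and> (k < j \<and> j < m \<or> j = m + 1)"
    using assms km by (auto simp: doubleton_eq_iff)
  finally have "crossings_from ?t [k..<m] i j
      = (if i = k \<and> (k < j \<and> j < m \<or> j = m + 1) then 1 else 0)"
    using km by (simp add: crossings_from_slide_right)
  moreover have "{m, m + 1} = {i, j} \<longleftrightarrow> i = m \<and> j = m + 1"
    using assms by (auto simp: doubleton_eq_iff)
  ultimately show ?thesis
    using km by (simp add: first_stages_def)
qed

end

section \<open>The full word and the positions of the optional pairs\<close>

theorem proposition17:
  fixes n k l m :: nat and M :: "nat mat"
  assumes "n > 0"
    and "1 \<le> k" and "k < m" and "m < l" and "l \<le> n"
    and "H_formation n k l m M"
  shows "CN_realizable n M"
proof -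
  note km = assms(2,3)
  let ?v = "first_stages k m"
  let ?p = "arrangement_after id ?v"
  \<comment> \<open>If \<open>k = m - 1\<close>, strand \<open>m - 1\<close> is the strand that slid
    away, but then the pair \<open>(m - 1, m + 1)\<close> is the required pair
    \<open>(k, m + 1)\<close>.\<close>
  have p: "?p (m - 2) = m - 1" if "k < m - 1"
    using that km by (auto simp: arrangement_after_first_stages)
  have p': "?p (m - 1) = m + 1" "?p m = k" "?p (m + 1) = m" "\<And>r. m + 2 \<le> r \<Longrightarrow> ?p r = r"
    using km by (auto simp: arrangement_after_first_stages)
  show ?thesis
  proof (cases "l = m + 1")
    case True
    show ?thesis
    proof (rule H_formation_CN_realizable[OF assms(6), of ?v ?p])
      show "set ?v \<subseteq> {1..<n}"
        using assms True by (auto simp: first_stages_def)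
      fix i j :: nat
      assume ij: "i < j"
      \<comment> \<open>For \<open>l = m + 1\<close> the entries \<open>(k, l)\<close> and
        \<open>(m, l)\<close> coincide with \<open>(k, m + 1)\<close> and \<open>(m, m + 1)\<close>,
        and the range \<open>m + 2 \<le> i < l\<close> is empty.\<close>
      have "(i, j) \<in> H_required k l m
          \<longleftrightarrow> i = m \<and> j = m + 1 \<or> i = k \<and> (k < j \<and> j < m \<or> j = m + 1)"
        unfolding H_required_iff True using ij km by auto
      then show "crossings_from id ?v i j = (if (i, j) \<in> H_required k l m then 1 else 0)"
        by (simp only: crossings_from_first_stages[OF km ij])
      assume bounds: "1 \<le> i" "j \<le> n"
        and opt: "(i, j) \<notin> H_required k l m" "(i, j) \<in> H_optional k l m"
      \<comment> \<open>The optional position \<open>(m + 1, l)\<close> lies on the diagonal here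
        and is excluded by \<open>i < j\<close>.\<close>
      consider "i = k" "j = m" | "i = m - 1" "j = m + 1" | "i = m" "j = m + 2"
        using opt(2) ij unfolding H_optional_iff True by blast
      then show "\<exists>c\<in>{1..<n}. {?p c, ?p (c + 1)} = {i, j}"
      proof cases
        case 1
        show ?thesis
          by (rule bexI[of _ m]) (use 1 p' assms True in auto)
      next
        case 2
        have "m - 1 \<noteq> k"
          using opt(1) 2 unfolding H_required_iff by simp
        then have k: "k < m - 1"
          using km by simp
        then have "m - 2 + 1 = m - 1"
          by simp
        then have "{?p (m - 2), ?p (m - 2 + 1)} = {i, j}"
          using 2 p[OF k] p' by simp
        moreover have "m - 2 \<in> {1..<n}"
          using k assms by auto
        ultimately show ?thesis ..
      next
        case 3
        \<comment> \<open>Strand \<open>m + 2\<close> has not moved and is right of strand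
          \<open>m\<close>; \<open>j \<le> n\<close> ensures that the letter \<open>m + 1\<close> is
          admissible.\<close>
        show ?thesis
          by (rule bexI[of _ "m + 1"]) (use 3 p' bounds in auto)
      qed
    qed simp
  next
    case False
    with assms have l: "m + 2 \<le> l"
      by simp
    \<comment> \<open>Strand \<open>l\<close> slides left to position \<open>m + 1\<close>, just
      right of \<open>k\<close>; the last letter \<open>m\<close> of \<open>u\<close> then crosses
      \<open>k\<close> and \<open>l\<close>.\<close>
    let ?s = "rev [m + 1..<l]"
    define u where "u = ?v @ ?s @ [m]"
    define q where "q = arrangement_after id u"
    define p2 where "p2 = arrangement_after ?p ?s"
    have p2: "p2 = (\<lambda>r. if r = m + 1 then ?p l
        else if m + 1 < r \<and> r \<le> l then ?p (r - 1) else ?p r)"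
      unfolding p2_def using l by (intro arrangement_after_slide_left) simp
    have q_eq: "q = p2 \<circ> Transposition.transpose m (m + 1)"
      by (simp add: q_def u_def p2_def)
    have q: "q (m - 2) = m - 1" if "k < m - 1"
      using that p km by (auto simp: q_eq p2)
    have q': "q (m - 1) = m + 1" "q m = l" "q (m + 1) = k" "q (m + 2) = m"
      "m + 2 < l \<Longrightarrow> q (m + 3) = m + 2"
      using p' km l by (auto simp: q_eq p2)
    show ?thesis
    proof (rule H_formation_CN_realizable[OF assms(6), of u q])
      show "set u \<subseteq> {1..<n}"
        using assms l by (auto simp: u_def first_stages_def)
      show "q = arrangement_after id u"
        by (rule q_def)
      fix i j :: nat
      assume ij: "i < j"
      \<comment> \<open>After the first stages position \<open>m + 1\<close> holds strand
        \<open>m\<close>, and every later position holds its own strand.\<close>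
      have "{m + 1..<l} = insert (m + 1) {m + 2..<l}"
        using l by auto
      then have "(\<exists>c\<in>{m + 1..<l}. {?p c, ?p l} = {i, j})
          \<longleftrightarrow> {m, l} = {i, j} \<or> (\<exists>c\<in>{m + 2..<l}. {c, l} = {i, j})"
        using p' l by simp
      also have "\<dots> \<longleftrightarrow> j = l \<and> (i = m \<or> m + 2 \<le> i \<and> i < l)"
        using ij l by (auto simp: doubleton_eq_iff)
      finally have "crossings_from ?p ?s i j
          = (if j = l \<and> (i = m \<or> m + 2 \<le> i \<and> i < l) then 1 else 0)"
        using l by (subst crossings_from_slide_left) (simp_all add: inj_arrangement_after)
      moreover have "crossings_from p2 [m] i j = (if i = k \<and> j = l then 1 else 0)"
        using ij km l p' by (auto simp: p2 doubleton_eq_iff)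
      ultimately have "crossings_from id u i j
          = (if i = m \<and> j = m + 1 \<or> i = k \<and> (k < j \<and> j < m \<or> j = m + 1) then 1 else 0)
            + ((if j = l \<and> (i = m \<or> m + 2 \<le> i \<and> i < l) then 1 else 0)
            + (if i = k \<and> j = l then 1 else 0))"
        unfolding u_def p2_def crossings_from_append crossings_from_first_stages[OF km ij] by simp
      \<comment> \<open>The stages cross disjoint sets of pairs: the first has
        \<open>j \<le> m + 1 < l\<close>, and the other two differ in \<open>i\<close> because
        \<open>k < m\<close>. Hence the sum is a single 0/1 value.\<close>
      also have "\<dots> = (if (i = m \<and> j = m + 1 \<or> i = k \<and> (k < j \<and> j < m \<or> j = m + 1))
          \<or> j = l \<and> (i = m \<or> m + 2 \<le> i \<and> i < l) \<or> i = k \<and> j = l then 1 else 0)"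
      proof -
        have "\<lbrakk>\<not> (A \<and> B); \<not> (A \<and> C); \<not> (B \<and> C)\<rbrakk> \<Longrightarrow>
            (if A then 1 else 0) + ((if B then 1 else 0) + (if C then 1 else 0))
              = (if A \<or> B \<or> C then 1 else (0::nat))" for A B C
          by auto
        then show ?thesis
          by rule (use km l in auto)
      qed
      also have "\<dots> = (if (i, j) \<in> H_required k l m then 1 else 0)"
        unfolding H_required_iff using km ij by (intro if_cong refl) auto
      finally show "crossings_from id u i j = (if (i, j) \<in> H_required k l m then 1 else 0)" .
      assume bounds: "1 \<le> i" "j \<le> n"
        and opt: "(i, j) \<notin> H_required k l m" "(i, j) \<in> H_optional k l m"
      consider "i = k" "j = m" | "i = m + 1" "j = l" | "i = m - 1" "j = m + 1" | "i = m" "j = m + 2"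
        using opt(2) unfolding H_optional_iff by blast
      then show "\<exists>c\<in>{1..<n}. {q c, q (c + 1)} = {i, j}"
      proof cases
        case 1
        show ?thesis
          by (rule bexI[of _ "m + 1"]) (use 1 q' assms l in auto)
      next
        case 2
        show ?thesis
          by (rule bexI[of _ "m - 1"]) (use 2 q' assms in auto)
      next
        case 3
        have "m - 1 \<noteq> k"
          using opt(1) 3 unfolding H_required_iff by simp
        then have k: "k < m - 1"
          using km by simp
        then have "m - 2 + 1 = m - 1"
          by simp
        then have "{q (m - 2), q (m - 2 + 1)} = {i, j}"
          using 3 q[OF k] q' by simp
        moreover have "m - 2 \<in> {1..<n}"
          using k assms by auto
        ultimately show ?thesis ..
      next
        case 4
        \<comment> \<open>If \<open>l = m + 2\<close>, strand \<open>m + 2\<close> would be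
          \<open>l\<close> itself, now left of \<open>k\<close>; but \<open>(m, l)\<close> is then a
          required pair.\<close>
        have "m + 2 \<noteq> l"
          using opt(1) 4 unfolding H_required_iff by simp
        then have l': "m + 2 < l"
          using l by simp
        show ?thesis
          by (rule bexI[of _ "m + 2"]) (use 4 q'(4) q'(5)[OF l'] assms(5) l' in \<open>auto simp: numeral_3_eq_3\<close>)
      qed
    qed
  qed
qed

end
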